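(* Let $\mathcal{H}$ be a $k$-uniform hypergraph with $m$ edges. If its incidence energy $\mathtt{BE}(\mathcal{H})$ is a rational number, then it is an integer. Moreover: (a) if $k$ is even, then $\mathtt{BE}(\mathcal{H})$ is even; (b) if $k$ is odd, then $\mathtt{BE}(\mathcal{H})$ and $m$ have the same parity.
   Context: A hypergraph $\mathcal{H}=(V,E)$ has a finite vertex set $V$ and an edge set $E\subseteq 2^V$; it is $k$-uniform ($k\ge2$) if every edge has exactly $k$ vertices. Its incidence matrix $\mathbf{B}$ is the $|V|\times|E|$ matrix with $b(v,e)=1$ if $v\in e$ and $0$ otherwise. The incidence energy $\mathtt{BE}(\mathcal{H})$ is the sum of the singular values of $\mathbf{B}$ (i.e. of the square roots of the eigenvalues of $\mathbf{B}\mathbf{B}^T$) if $\mathcal{H}$ has at least one edge, and $0$ otherwise. *)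

theory Defs
  imports Complex_Main "HOL-Library.Multiset" "Jordan_Normal_Form.Char_Poly"
begin

definition hypergraph :: "'a set \<Rightarrow> 'a set set \<Rightarrow> bool" where
  "hypergraph V E \<longleftrightarrow> finite V \<and> E \<subseteq> Pow V"

definition uniform_hypergraph :: "nat \<Rightarrow> 'a set \<Rightarrow> 'a set set \<Rightarrow> bool" where
  "uniform_hypergraph k V E \<longleftrightarrow> hypergraph V E \<and> (\<forall>e\<in>E. card e = k)"

text \<open>Rows and columns of a \<^typ>\<open>'a mat\<close> are numbered from 0, so the incidence matrix is taken
  with respect to an ordering of the vertices and an ordering of the edges.\<close>

definition incidence_matrix :: "'a list \<Rightarrow> 'a set list \<Rightarrow> real mat" where
  "incidence_matrix vs es =
     mat (length vs) (length es) (\<lambda>(i, j). if vs ! i \<in> es ! j then 1 else 0)"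

text \<open>Eigenvalues with algebraic multiplicity. Since \<open>A A\<^sup>T\<close> is real symmetric and positive
  semidefinite, its characteristic polynomial splits over the reals with nonnegative roots, so
  passing to the real roots loses nothing.\<close>

definition singular_values :: "real mat \<Rightarrow> real multiset" where
  "singular_values A = image_mset sqrt (proots (char_poly (A * transpose_mat A)))"

definition enumeration :: "'b set \<Rightarrow> 'b list" where
  "enumeration S = (SOME xs. distinct xs \<and> set xs = S)"

definition incidence_energy :: "'a set \<Rightarrow> 'a set set \<Rightarrow> real" where
  "incidence_energy V E =
     (if E = {} then 0
      else sum_mset (singular_values (incidence_matrix (enumeration V) (enumeration E))))"

lemma enumeration:
  assumes "finite S"
  shows "distinct (enumeration S)" "set (enumeration S) = S"
  using someI_ex[of "\<lambda>xs. distinct xs \<and> set xs = S"] finite_distinct_list[OF assms]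
  unfolding enumeration_def by auto

lemma sum_nth_distinct:
  assumes "distinct xs"
  shows "(\<Sum>l = 0..<length xs. f (xs ! l)) = sum f (set xs)"
  using sum.reindex_bij_betw[OF bij_betw_nth[OF assms refl refl], of f]
  by (simp add: atLeast0LessThan)

lemma gram_incidence_matrix:
  assumes "distinct es"
  shows "incidence_matrix vs es * transpose_mat (incidence_matrix vs es) =
    mat (length vs) (length vs)
      (\<lambda>(i, j). \<Sum>e\<in>set es. if vs ! i \<in> e \<and> vs ! j \<in> e then 1 else 0)"
  by (rule eq_matI)
    (auto simp: incidence_matrix_def scalar_prod_def sum_nth_distinct[OF assms, symmetric]
      intro!: sum.cong)

text \<open>The singular values do not depend on the chosen orderings.\<close>

lemma singular_values_incidence_matrix_cong:
  assumes vs: "distinct vs" "distinct vs'" "set vs = set vs'"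
    and es: "distinct es" "distinct es'" "set es = set es'"
  shows "singular_values (incidence_matrix vs es) = singular_values (incidence_matrix vs' es')"
proof -
  define n where "n = length vs"
  have n': "length vs' = n"
    using vs unfolding n_def by (metis distinct_card)
  define c :: "'a \<Rightarrow> 'a \<Rightarrow> real" where
    "c x y = (\<Sum>e\<in>set es. if x \<in> e \<and> y \<in> e then 1 else 0)" for x y
  define M where "M = mat n n (\<lambda>(i, j). c (vs ! i) (vs ! j))"
  define M' where "M' = mat n n (\<lambda>(i, j). c (vs' ! i) (vs' ! j))"
  define P :: "real mat" where "P = mat n n (\<lambda>(i, j). if vs ! i = vs' ! j then 1 else 0)"
  define Q :: "real mat" where "Q = mat n n (\<lambda>(i, j). if vs' ! i = vs ! j then 1 else 0)"
  have carr: "M \<in> carrier_mat n n" "M' \<in> carrier_mat n n" "P \<in> carrier_mat n n" "Q \<in> carrier_mat n n"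
    by (simp_all add: M_def M'_def P_def Q_def)
  have s: "(\<Sum>l = 0..<n. f (vs ! l)) = sum f (set vs)"
    and s': "(\<Sum>l = 0..<n. f (vs' ! l)) = sum f (set vs)" for f :: "'a \<Rightarrow> real"
    using sum_nth_distinct[OF vs(1), of f] sum_nth_distinct[OF vs(2), of f] n' vs(3)
    by (simp_all add: n_def)
  have mem: "vs ! i \<in> set vs" "vs' ! i \<in> set vs" if "i < n" for i
    using that nth_mem[of i vs] nth_mem[of i vs'] unfolding n' vs(3) n_def[symmetric] by simp_all
  have inj: "vs ! i = vs ! j \<longleftrightarrow> i = j" "vs' ! i = vs' ! j \<longleftrightarrow> i = j" if "i < n" "j < n" for i j
    using that n' vs by (auto simp: n_def nth_eq_iff_index_eq)
  have PQ: "P * Q = 1\<^sub>m n"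
  proof (rule eq_matI)
    fix i j assume "i < dim_row (1\<^sub>m n :: real mat)" "j < dim_col (1\<^sub>m n :: real mat)"
    then have ij: "i < n" "j < n" by auto
    have "(P * Q) $$ (i, j) =
        (\<Sum>l = 0..<n. (\<lambda>x. (if vs ! i = x then 1 else 0) * (if x = vs ! j then 1 else 0)) (vs' ! l))"
      using ij by (simp add: P_def Q_def scalar_prod_def)
    also have "\<dots> = (\<Sum>x\<in>set vs. if vs ! i = x then (if x = vs ! j then 1 else 0) else 0)"
      unfolding s'[symmetric] by (rule sum.cong) auto
    also have "\<dots> = (if i = j then 1 else 0)"
      using ij mem inj by simp
    finally show "(P * Q) $$ (i, j) = 1\<^sub>m n $$ (i, j)" using ij by simp
  qed (simp_all add: P_def Q_def)
  have QP: "Q * P = 1\<^sub>m n"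
    by (rule mat_mult_left_right_inverse[OF carr(3,4) PQ])
  have MP: "M * P = P * M'"
  proof (rule eq_matI)
    fix i j assume "i < dim_row (P * M')" "j < dim_col (P * M')"
    then have ij: "i < n" "j < n" by (auto simp: P_def M'_def)
    have "(M * P) $$ (i, j) =
        (\<Sum>l = 0..<n. (\<lambda>x. c (vs ! i) x * (if x = vs' ! j then 1 else 0)) (vs ! l))"
      using ij by (simp add: M_def P_def scalar_prod_def)
    also have "\<dots> = (\<Sum>x\<in>set vs. if x = vs' ! j then c (vs ! i) x else 0)"
      unfolding s[symmetric] by (rule sum.cong) auto
    also have "\<dots> = c (vs ! i) (vs' ! j)"
      using ij mem by simp
    also have "\<dots> = (\<Sum>x\<in>set vs. if vs ! i = x then c x (vs' ! j) else 0)"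
      using ij mem by simp
    also have "\<dots> = (\<Sum>l = 0..<n. (\<lambda>x. (if vs ! i = x then 1 else 0) * c x (vs' ! j)) (vs' ! l))"
      unfolding s'[symmetric] by (rule sum.cong) auto
    also have "\<dots> = (P * M') $$ (i, j)"
      using ij by (simp add: M'_def P_def scalar_prod_def)
    finally show "(M * P) $$ (i, j) = (P * M') $$ (i, j)" .
  qed (simp_all add: P_def M_def M'_def)
  have "M = M * (P * Q)"
    using carr PQ by simp
  also have "\<dots> = P * M' * Q"
    unfolding assoc_mult_mat[OF carr(1,3,4), symmetric] MP ..
  finally have "similar_mat_wit M M' P Q"
    using carr PQ QP by (intro similar_mat_witI[of _ _ n]) auto
  then have "char_poly M = char_poly M'"
    by (intro char_poly_similar) (auto simp: similar_mat_def)
  then show ?thesis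
    unfolding singular_values_def gram_incidence_matrix[OF es(1)] gram_incidence_matrix[OF es(2)]
    by (simp add: M_def M'_def c_def n' es(3) flip: n_def)
qed

end

theory Submission
  imports Defs "Jordan_Normal_Form.Schur_Decomposition"
begin

text \<open>The singular values \<open>\<sigma>\<^sub>i\<close> are square roots of eigenvalues of an integer matrix, hence algebraic
  integers, so a rational sum \<open>z = \<Sum> \<sigma>\<^sub>i\<close> is an integer. Moreover
  \<open>z\<^sup>2 = \<Sum> \<sigma>\<^sub>i\<^sup>2 + 2 c\<close>, where \<open>c = \<Sum>\<^bsub>i < j\<^esub> \<sigma>\<^sub>i \<sigma>\<^sub>j\<close> is an algebraic integer and
  \<open>\<Sum> \<sigma>\<^sub>i\<^sup>2\<close> is the trace of \<open>B B\<^sup>T\<close>, which counts incidences and equals \<open>k m\<close>. So \<open>c\<close> is a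
  rational algebraic integer, hence an integer, and \<open>z \<equiv> z\<^sup>2 \<equiv> k m\<close> modulo 2.\<close>

section \<open>Algebraic integers\<close>

text \<open>The characteristic polynomial of an integer matrix is monic with integer
  coefficients.\<close>

lemma algebraic_int_root_char_poly:
  fixes A :: "int mat" and x :: "'a :: field_char_0"
  assumes A: "A \<in> carrier_mat n n" and root: "poly (char_poly (map_mat of_int A)) x = 0"
  shows "algebraic_int x"
  unfolding algebraic_int_altdef_ipoly
proof (intro exI conjI)
  show "poly (map_poly of_int (char_poly A)) x = 0"
    using root by (simp add: of_int_hom.char_poly_hom[OF A])
  show "lead_coeff (char_poly A) = 1"
    using degree_monic_char_poly[OF A] by simp
qed

text \<open>The determinant trick: multiplication by \<open>x\<close> acts on the generators
  \<open>v\<close> through an integer matrix, so the vector of generators, nonzero because of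
  \<open>v i0\<close>, is an eigenvector for \<open>x\<close>, and \<open>x\<close> is a root of the
  characteristic polynomial.\<close>

lemma algebraic_int_if_stable_lattice:
  fixes x :: "'a :: field_char_0" and v :: "'b \<Rightarrow> 'a"
  assumes fin: "finite I" and nz: "i0 \<in> I" "v i0 \<noteq> 0"
    and eq: "\<And>i. i \<in> I \<Longrightarrow> x * v i = (\<Sum>j\<in>I. of_int (a i j) * v j)"
  shows "algebraic_int x"
proof -
  obtain xs where xs: "distinct xs" "set xs = I"
    using finite_distinct_list[OF fin] by auto
  define n where "n = length xs"
  define A :: "int mat" where "A = mat n n (\<lambda>(i, j). a (xs ! i) (xs ! j))"
  define w where "w = vec n (\<lambda>i. v (xs ! i))"
  have A: "A \<in> carrier_mat n n" by (simp add: A_def)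
  obtain l where l: "l < n" "xs ! l = i0"
    using nz xs by (auto simp: in_set_conv_nth n_def)
  have "eigenvector (map_mat of_int A) w x"
    unfolding eigenvector_def
  proof (intro conjI)
    show "w \<in> carrier_vec (dim_row (map_mat of_int A :: 'a mat))"
      by (simp add: A_def w_def)
    have "w $ l \<noteq> 0" using l nz by (simp add: w_def)
    then show "w \<noteq> 0\<^sub>v (dim_row (map_mat of_int A :: 'a mat))"
      using l A by auto
    show "map_mat of_int A *\<^sub>v w = x \<cdot>\<^sub>v w"
    proof (rule eq_vecI)
      fix i assume "i < dim_vec (x \<cdot>\<^sub>v w)"
      then have i: "i < n" by (simp add: w_def)
      then have "xs ! i \<in> I" using xs by (auto simp: n_def)
      have "(map_mat of_int A *\<^sub>v w) $ i = (\<Sum>l = 0..<n. of_int (a (xs ! i) (xs ! l)) * v (xs ! l))"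
        using i by (simp add: A_def w_def scalar_prod_def)
      also have "\<dots> = (\<Sum>j\<in>I. of_int (a (xs ! i) j) * v j)"
        using sum_nth_distinct[OF xs(1), of "\<lambda>j. of_int (a (xs ! i) j) * v j"] xs(2)
        by (simp add: n_def)
      also have "\<dots> = x * v (xs ! i)"
        using eq[OF \<open>xs ! i \<in> I\<close>] by simp
      finally show "(map_mat of_int A *\<^sub>v w) $ i = (x \<cdot>\<^sub>v w) $ i"
        using i by (simp add: w_def)
    qed (simp add: A_def w_def)
  qed
  then have "eigenvalue (map_mat of_int A) x" by (auto simp: eigenvalue_def)
  then have "poly (char_poly (map_mat of_int A)) x = 0"
    using eigenvalue_root_char_poly[of "map_mat of_int A" n x] A by simp
  then show ?thesis by (rule algebraic_int_root_char_poly[OF A])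
qed

text \<open>The powers of \<open>x\<close> below the degree of a monic integer polynomial vanishing
  at \<open>x\<close> span a lattice stable under multiplication by \<open>x\<close>. Such lattices
  for two numbers are combined in \<open>algebraic_int_add_mult\<close>.\<close>

lemma algebraic_int_powers:
  fixes x :: "'a :: field_char_0"
  assumes "algebraic_int x"
  obtains n c where "n > 0" "\<And>i. i < n \<Longrightarrow> x * x ^ i = (\<Sum>j<n. of_int (c i j) * x ^ j)"
proof -
  obtain p where p: "poly (map_poly of_int p) x = 0" "lead_coeff p = 1"
    using assms unfolding algebraic_int_altdef_ipoly by auto
  define n where "n = degree p"
  \<comment> \<open>A constant polynomial with leading coefficient 1 has no root. Positivity puts
    the nonzero generator \<open>x ^ 0\<close> into the lattice.\<close>
  have "n > 0"
  proof (rule ccontr)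
    assume "\<not> n > 0"
    then obtain a where "p = [:a:]"
      by (metis n_def degree_eq_zeroE gr0I)
    then show False using p by simp
  qed
  have "0 = (\<Sum>i\<le>n. of_int (coeff p i) * x ^ i)"
    using p(1) by (simp add: poly_altdef n_def)
  also have "\<dots> = (\<Sum>i<n. of_int (coeff p i) * x ^ i) + x ^ n"
    using p(2) by (simp add: n_def flip: lessThan_Suc_atMost)
  finally have top: "x ^ n = (\<Sum>i<n. of_int (- coeff p i) * x ^ i)"
    by (simp add: sum_negf eq_neg_iff_add_eq_0 add.commute)
  \<comment> \<open>The companion matrix: each row shifts to the next power, except the last one,
    which expands \<open>x ^ n\<close> by \<open>top\<close>.\<close>
  define c where "c i j = (if Suc i < n then of_bool (j = Suc i) else - coeff p j)" for i j
  have "x * x ^ i = (\<Sum>j<n. of_int (c i j) * x ^ j)" if "i < n" for i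
  proof (cases "Suc i < n")
    case True
    have "(\<Sum>j<n. of_int (c i j) * x ^ j) = (\<Sum>j<n. if j = Suc i then x ^ j else 0)"
      using True by (intro sum.cong) (auto simp: c_def)
    then show ?thesis using True by simp
  next
    case False
    then have "Suc i = n" using that by simp
    then have "x * x ^ i = x ^ n" by (metis power_Suc)
    then show ?thesis using top False by (simp add: c_def)
  qed
  then show thesis using \<open>n > 0\<close> that by blast
qed

text \<open>The products \<open>x ^ i * y ^ j\<close> span a lattice stable under multiplication by
  \<open>x\<close> and by \<open>y\<close>, hence by their product and sum. The generator at
  \<open>(0, 0)\<close> is 1, so it is nonzero.\<close>

lemma algebraic_int_add_mult:
  fixes x y :: "'a :: field_char_0"
  assumes "algebraic_int x" "algebraic_int y"
  shows algebraic_int_add: "algebraic_int (x + y)"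
    and algebraic_int_mult: "algebraic_int (x * y)"
proof -
  obtain n c where n: "n > 0"
    and c: "\<And>i. i < n \<Longrightarrow> x * x ^ i = (\<Sum>j<n. of_int (c i j) * x ^ j)"
    using algebraic_int_powers[OF assms(1)] by blast
  obtain m d where m: "m > 0"
    and d: "\<And>i. i < m \<Longrightarrow> y * y ^ i = (\<Sum>j<m. of_int (d i j) * y ^ j)"
    using algebraic_int_powers[OF assms(2)] by blast
  define I where "I = {..<n} \<times> {..<m}"
  define v where "v = (\<lambda>(i, j). x ^ i * y ^ j)"
  have I: "finite I" "(0, 0) \<in> I" "v (0, 0) \<noteq> 0"
    using n m by (auto simp: I_def v_def)
  have sum_I: "sum f I = (\<Sum>i<n. \<Sum>j<m. f (i, j))" for f :: "nat \<times> nat \<Rightarrow> 'a"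
    unfolding I_def by (simp add: sum.cartesian_product)
  \<comment> \<open>The matrix of multiplication by \<open>x * y\<close> is the Kronecker product of
    \<open>c\<close> and \<open>d\<close>.\<close>
  show "algebraic_int (x * y)"
  proof (rule algebraic_int_if_stable_lattice[where v = v, OF I, where a = "\<lambda>(i, j) (i', j'). c i i' * d j j'"])
    fix p assume "p \<in> I"
    then obtain i j where p: "p = (i, j)" "i < n" "j < m" by (auto simp: I_def)
    have "x * y * v p = (x * x ^ i) * (y * y ^ j)" by (simp add: p v_def)
    also have "\<dots> = (\<Sum>i'<n. \<Sum>j'<m. (of_int (c i i') * x ^ i') * (of_int (d j j') * y ^ j'))"
      unfolding c[OF p(2)] d[OF p(3)] by (rule sum_product)
    finally show "x * y * v p = (\<Sum>q\<in>I. of_int ((\<lambda>(i, j) (i', j'). c i i' * d j j') p q) * v q)"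
      by (simp add: sum_I p v_def mult_ac)
  qed
  \<comment> \<open>Here it is the Kronecker sum: \<open>c\<close> moves the exponent of
    \<open>x\<close> and fixes that of \<open>y\<close>, and \<open>d\<close> does the
    converse.\<close>
  show "algebraic_int (x + y)"
  proof (rule algebraic_int_if_stable_lattice[where v = v, OF I, where
        a = "\<lambda>(i, j) (i', j'). c i i' * of_bool (j' = j) + of_bool (i' = i) * d j j'"])
    fix p assume "p \<in> I"
    then obtain i j where p: "p = (i, j)" "i < n" "j < m" by (auto simp: I_def)
    have "(x + y) * v p = (x * x ^ i) * y ^ j + x ^ i * (y * y ^ j)"
      by (simp add: p v_def algebra_simps)
    also have "(x * x ^ i) * y ^ j = (\<Sum>i'<n. of_int (c i i') * x ^ i' * y ^ j)"
      unfolding c[OF p(2)] by (simp add: sum_distrib_right)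
    also have "\<dots> = (\<Sum>i'<n. \<Sum>j'<m. of_int (c i i' * of_bool (j' = j)) * (x ^ i' * y ^ j'))"
      using p(3) by (intro sum.cong refl) (simp add: of_bool_def if_distrib if_distribR mult_ac cong: if_cong)
    also have "x ^ i * (y * y ^ j) = (\<Sum>j'<m. of_int (d j j') * (x ^ i * y ^ j'))"
      unfolding d[OF p(3)] by (simp add: sum_distrib_left mult_ac)
    also have "\<dots> = (\<Sum>j'<m. \<Sum>i'<n. of_int (of_bool (i' = i) * d j j') * (x ^ i' * y ^ j'))"
      using p(2) by (intro sum.cong refl) (simp add: of_bool_def if_distrib if_distribR mult_ac cong: if_cong)
    also have "\<dots> = (\<Sum>i'<n. \<Sum>j'<m. of_int (of_bool (i' = i) * d j j') * (x ^ i' * y ^ j'))"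
      by (rule sum.swap)
    finally show "(x + y) * v p = (\<Sum>q\<in>I. of_int ((\<lambda>(i, j) (i', j').
        c i i' * of_bool (j' = j) + of_bool (i' = i) * d j j') p q) * v q)"
      by (simp add: sum_I p v_def sum.distrib distrib_right)
  qed
qed

lemma algebraic_int_sum_mset:
  fixes M :: "'a :: field_char_0 multiset"
  assumes "\<And>x. x \<in># M \<Longrightarrow> algebraic_int x"
  shows "algebraic_int (sum_mset M)"
  using assms by (induction M) (auto intro: algebraic_int_add)

text \<open>The witness is the second elementary symmetric function of \<open>M\<close>, built up by
  induction: a new element \<open>a\<close> adds the cross term
  \<open>a * sum_mset M\<close>.\<close>

lemma square_sum_mset_algebraic_int:
  fixes M :: "'a :: field_char_0 multiset"
  assumes "\<And>x. x \<in># M \<Longrightarrow> algebraic_int x"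
  obtains c where "algebraic_int c" "(sum_mset M)\<^sup>2 = (\<Sum>x\<in>#M. x\<^sup>2) + 2 * c"
proof -
  have "\<exists>c. algebraic_int c \<and> (sum_mset M)\<^sup>2 = (\<Sum>x\<in>#M. x\<^sup>2) + 2 * c"
    using assms
  proof (induction M)
    case empty
    show ?case by (intro exI[of _ 0]) simp
  next
    case (add a M)
    then obtain c where c: "algebraic_int c" "(sum_mset M)\<^sup>2 = (\<Sum>x\<in>#M. x\<^sup>2) + 2 * c"
      by auto
    have "algebraic_int (c + a * sum_mset M)"
      using add.prems c(1)
      by (intro algebraic_int_add algebraic_int_mult algebraic_int_sum_mset) auto
    moreover have "(sum_mset (add_mset a M))\<^sup>2
        = (\<Sum>x\<in>#add_mset a M. x\<^sup>2) + 2 * (c + a * sum_mset M)"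
      unfolding sum_mset.add_mset image_mset_add_mset power2_sum c(2)
      by (simp only: distrib_left mult.assoc add_ac)
    ultimately show ?case by blast
  qed
  then show thesis using that by blast
qed

section \<open>Spectra of Gram matrices\<close>

text \<open>Pairing the eigenvector equation with the conjugate of w gives z |w|^2 = |B^T w|^2.
  Working with complex \<open>z\<close> rules out nonreal eigenvalues at the same time as negative
  ones.\<close>

lemma eigenvalue_gram_nonneg:
  fixes B :: "real mat"
  assumes B: "B \<in> carrier_mat n m"
    and ev: "eigenvalue (map_mat complex_of_real (B * transpose_mat B)) z"
  obtains r where "r \<ge> 0" "z = complex_of_real r"
proof -
  let ?A = "map_mat complex_of_real (B * transpose_mat B)"
  obtain w where w: "w \<in> carrier_vec n" "w \<noteq> 0\<^sub>v n" "?A *\<^sub>v w = z \<cdot>\<^sub>v w"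
    using ev B unfolding eigenvalue_def eigenvector_def by auto
  \<comment> \<open>\<open>u\<close> is B^T w; \<open>s\<close> and \<open>t\<close> are the squared
    norms of \<open>w\<close> and \<open>u\<close>, so the eigenvalue will be
    \<open>t / s\<close>.\<close>
  define u where "u l = (\<Sum>j<n. of_real (B $$ (j, l)) * w $ j)" for l
  define s where "s = (\<Sum>i<n. (cmod (w $ i))\<^sup>2)"
  define t where "t = (\<Sum>l<m. (cmod (u l))\<^sup>2)"
  have row: "z * w $ i = (\<Sum>l<m. of_real (B $$ (i, l)) * u l)" if i: "i < n" for i
  proof -
    have "z * w $ i = (?A *\<^sub>v w) $ i" using w i by simp
    also have "\<dots> = (\<Sum>j<n. (\<Sum>l<m. of_real (B $$ (i, l)) * of_real (B $$ (j, l))) * w $ j)"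
      using B w(1) i by (simp add: scalar_prod_def lessThan_atLeast0)
    also have "\<dots> = (\<Sum>j<n. \<Sum>l<m. of_real (B $$ (i, l)) * (of_real (B $$ (j, l)) * w $ j))"
      by (simp add: sum_distrib_right mult.assoc)
    also have "\<dots> = (\<Sum>l<m. of_real (B $$ (i, l)) * u l)"
      by (subst sum.swap) (simp add: u_def sum_distrib_left)
    finally show ?thesis .
  qed
  have "z * of_real s = (\<Sum>i<n. cnj (w $ i) * (z * w $ i))"
    by (simp add: s_def sum_distrib_left complex_norm_square mult_ac del: of_real_power)
  also have "\<dots> = (\<Sum>i<n. \<Sum>l<m. cnj (of_real (B $$ (i, l)) * w $ i) * u l)"
    by (intro sum.cong refl) (simp add: row sum_distrib_left mult_ac)
  also have "\<dots> = (\<Sum>l<m. cnj (u l) * u l)"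
    by (subst sum.swap) (simp add: u_def sum_distrib_right)
  also have "\<dots> = of_real t"
    by (simp add: t_def complex_norm_square mult_ac del: of_real_power)
  finally have zs: "z * of_real s = of_real t" .
  obtain i where i: "i < n" "w $ i \<noteq> 0"
    using w by (metis carrier_vecD eq_vecI index_zero_vec)
  have "0 < (cmod (w $ i))\<^sup>2" using i by simp
  also have "\<dots> \<le> s"
    unfolding s_def using i by (intro member_le_sum) auto
  finally have "s > 0" .
  show thesis
  proof (rule that)
    show "t / s \<ge> 0" using \<open>s > 0\<close> by (simp add: t_def sum_nonneg)
    show "z = complex_of_real (t / s)" using zs \<open>s > 0\<close> by (simp add: field_simps)
  qed
qed

text \<open>Over the complex numbers the polynomial factors completely, and its roots are
  eigenvalues, hence real and nonnegative. The resulting real factorization determines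
  \<open>proots\<close> and allows a Schur decomposition over the reals.\<close>

lemma char_poly_gram_splits:
  fixes B :: "real mat"
  assumes B: "B \<in> carrier_mat n m"
  obtains rs where "char_poly (B * transpose_mat B) = (\<Prod>r\<leftarrow>rs. [:- r, 1:])" "\<forall>r\<in>set rs. r \<ge> 0"
proof -
  let ?A = "B * transpose_mat B"
  let ?C = "map_mat complex_of_real ?A"
  have A: "?A \<in> carrier_mat n n" and C: "?C \<in> carrier_mat n n" using B by auto
  obtain zs where zs: "char_poly ?C = (\<Prod>z\<leftarrow>zs. [:- z, 1:])"
    using char_poly_factorized[OF C] by blast
  have real: "Re z \<ge> 0 \<and> complex_of_real (Re z) = z" if "z \<in> set zs" for z
  proof -
    have "poly (char_poly ?C) z = 0"
      using that unfolding zs by (simp add: poly_prod_list prod_list_zero_iff image_iff)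
    then have "eigenvalue ?C z" using eigenvalue_root_char_poly[OF C] by simp
    then show ?thesis using eigenvalue_gram_nonneg[OF B] by (metis Re_complex_of_real)
  qed
  define rs where "rs = map Re zs"
  interpret of_real_poly: map_poly_comm_ring_hom complex_of_real ..
  have "map_poly complex_of_real (\<Prod>r\<leftarrow>rs. [:- r, 1:]) = (\<Prod>r\<leftarrow>rs. [:- complex_of_real r, 1:])"
    by (simp add: of_real_poly.hom_prod_list o_def)
  also have "\<dots> = char_poly ?C"
    unfolding zs rs_def using real by (auto intro!: arg_cong[of _ _ prod_list])
  also have "\<dots> = map_poly complex_of_real (char_poly ?A)"
    by (rule of_real_hom.char_poly_hom[OF A])
  \<comment> \<open>The embedding of the reals is injective, so coefficients can be compared over
    the reals.\<close>
  finally have "char_poly ?A = (\<Prod>r\<leftarrow>rs. [:- r, 1:])"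
    by (simp add: poly_eq_iff coeff_map_poly)
  then show thesis using that[of rs] real by (auto simp: rs_def)
qed

lemma trace_mult_commute:
  fixes A B :: "'a :: comm_semiring_0 mat"
  assumes "A \<in> carrier_mat n m" "B \<in> carrier_mat m n"
  shows "(\<Sum>i<n. (A * B) $$ (i, i)) = (\<Sum>i<m. (B * A) $$ (i, i))"
proof -
  have "(\<Sum>i<n. (A * B) $$ (i, i)) = (\<Sum>i<n. \<Sum>j<m. A $$ (i, j) * B $$ (j, i))"
    using assms by (simp add: scalar_prod_def lessThan_atLeast0)
  also have "\<dots> = (\<Sum>j<m. \<Sum>i<n. B $$ (j, i) * A $$ (i, j))"
    by (subst sum.swap) (simp add: mult.commute)
  also have "\<dots> = (\<Sum>j<m. (B * A) $$ (j, j))"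
    using assms by (simp add: scalar_prod_def lessThan_atLeast0)
  finally show ?thesis .
qed

text \<open>Schur decomposition makes \<open>A\<close> similar to a matrix with the roots on its
  diagonal, and \<open>trace_mult_commute\<close> makes the trace invariant under
  similarity.\<close>

lemma trace_eq_sum_roots_char_poly:
  fixes A :: "'a :: conjugatable_ordered_field mat"
  assumes A: "A \<in> carrier_mat n n" and split: "char_poly A = (\<Prod>r\<leftarrow>rs. [:- r, 1:])"
  shows "(\<Sum>i<n. A $$ (i, i)) = sum_list rs"
proof -
  obtain T P Q where "schur_decomposition A rs = (T, P, Q)"
    by (cases "schur_decomposition A rs")
  from schur_decomposition[OF A split this]
  have sim: "similar_mat_wit A T P Q" and diag: "diag_mat T = rs" by auto
  note wit = similar_mat_witD2[OF A sim]
  have carr: "T \<in> carrier_mat n n" "P \<in> carrier_mat n n" "Q \<in> carrier_mat n n" using wit by auto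
  have "(\<Sum>i<n. A $$ (i, i)) = (\<Sum>i<n. (P * (T * Q)) $$ (i, i))"
    using wit assoc_mult_mat[OF carr(2,1,3)] by simp
  also have "\<dots> = (\<Sum>i<n. (T * Q * P) $$ (i, i))"
    using carr by (intro trace_mult_commute) auto
  also have "T * Q * P = T"
    using wit assoc_mult_mat[OF carr(1,3,2)] by simp
  also have "(\<Sum>i<n. T $$ (i, i)) = sum_list (diag_mat T)"
    using carr by (simp add: diag_mat_def lessThan_atLeast0 interv_sum_list_conv_sum_set_nat)
  finally show ?thesis by (simp add: diag)
qed

lemma proots_prod_list_linear:
  "proots (\<Prod>r\<leftarrow>rs. [:- r, 1:]) = mset (rs :: 'a :: idom list)"
proof (induction rs)
  case (Cons r rs)
  have "(\<Prod>r\<leftarrow>rs. [:- r, 1:]) \<noteq> 0" by (simp add: prod_list_zero_iff image_iff)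
  then show ?case using Cons by (simp add: proots_mult del: mult_pCons_left)
qed simp

lemma sum_squares_singular_values:
  assumes B: "B \<in> carrier_mat n m"
  shows "(\<Sum>s\<in>#singular_values B. s\<^sup>2) = (\<Sum>i<n. (B * transpose_mat B) $$ (i, i))"
proof -
  obtain rs where rs: "char_poly (B * transpose_mat B) = (\<Prod>r\<leftarrow>rs. [:- r, 1:])"
    "\<forall>r\<in>set rs. r \<ge> 0"
    using char_poly_gram_splits[OF B] by blast
  have "(\<Sum>s\<in>#singular_values B. s\<^sup>2) = (\<Sum>r\<in>#mset rs. (sqrt r)\<^sup>2)"
    by (simp add: singular_values_def rs proots_prod_list_linear multiset.map_comp o_def)
  \<comment> \<open>Nonnegativity of the roots matters: in general the square of
    \<open>sqrt r\<close> is the absolute value of \<open>r\<close>.\<close>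
  also have "\<dots> = (\<Sum>r\<in>#mset rs. r)"
    using rs(2) by (intro arg_cong[of _ _ sum_mset] image_mset_cong) auto
  also have "\<dots> = sum_list rs"
    by (simp add: sum_mset_sum_list)
  also have "\<dots> = (\<Sum>i<n. (B * transpose_mat B) $$ (i, i))"
    using B by (intro trace_eq_sum_roots_char_poly[symmetric, OF _ rs(1)]) auto
  finally show ?thesis .
qed

section \<open>Incidence energy\<close>

text \<open>The entries of the Gram matrix count common edges of two vertices, so they are integers
  and the eigenvalues are algebraic integers; taking square roots preserves this.\<close>

lemma algebraic_int_singular_values_incidence_matrix:
  assumes es: "distinct es" and s: "s \<in># singular_values (incidence_matrix vs es)"
  shows "algebraic_int s"
proof -
  let ?B = "incidence_matrix vs es"
  define n where "n = length vs"
  define A :: "int mat" where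
    "A = mat n n (\<lambda>(i, j). \<Sum>e\<in>set es. if vs ! i \<in> e \<and> vs ! j \<in> e then 1 else 0)"
  have A: "A \<in> carrier_mat n n" by (simp add: A_def)
  have BA: "?B * transpose_mat ?B = map_mat of_int A"
    unfolding gram_incidence_matrix[OF es] A_def n_def
    by (rule eq_matI) (auto intro!: sum.cong)
  obtain x where x: "x \<in># proots (char_poly (map_mat of_int A :: real mat))" "s = sqrt x"
    using s by (auto simp: singular_values_def BA)
  have "poly (char_poly (map_mat of_int A)) x = 0"
    using x(1) by (cases "char_poly (map_mat of_int A :: real mat) = 0") auto
  then have "algebraic_int x" by (rule algebraic_int_root_char_poly[OF A])
  then show ?thesis using x(2) by auto
qed

text \<open>Double counting of incidences: the diagonal entries of the Gram matrix are the vertex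
  degrees.\<close>

lemma trace_gram_incidence_matrix:
  assumes vs: "distinct vs" and es: "distinct es" and sub: "\<And>e. e \<in> set es \<Longrightarrow> e \<subseteq> set vs"
  shows "(\<Sum>i<length vs. (incidence_matrix vs es * transpose_mat (incidence_matrix vs es)) $$ (i, i))
    = (\<Sum>e\<in>set es. real (card e))"
proof -
  have "(\<Sum>i<length vs. (incidence_matrix vs es * transpose_mat (incidence_matrix vs es)) $$ (i, i))
      = (\<Sum>i = 0..<length vs. \<Sum>e\<in>set es. if vs ! i \<in> e then 1 else 0)"
    by (simp add: gram_incidence_matrix[OF es] lessThan_atLeast0)
  also have "\<dots> = (\<Sum>v\<in>set vs. \<Sum>e\<in>set es. if v \<in> e then 1 else 0)"
    by (rule sum_nth_distinct[OF vs])
  also have "\<dots> = (\<Sum>e\<in>set es. \<Sum>v\<in>set vs. if v \<in> e then 1 else 0)"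
    by (rule sum.swap)
  also have "\<dots> = (\<Sum>e\<in>set es. real (card e))"
    using sub by (intro sum.cong refl) (simp add: Int_absorb1 flip: sum.inter_restrict)
  finally show ?thesis .
qed

lemma incidence_energy_square:
  assumes hyp: "uniform_hypergraph k V E"
  obtains c where "algebraic_int (incidence_energy V E)" "algebraic_int c"
    "(incidence_energy V E)\<^sup>2 = real (k * card E) + 2 * c"
proof (cases "E = {}")
  case True
  \<comment> \<open>Without edges the energy is 0 by convention and \<open>card E\<close> is 0, so
    \<open>c = 0\<close> works.\<close>
  then show thesis using that[of 0] by (simp add: incidence_energy_def)
next
  case False
  have V: "finite V" and E: "E \<subseteq> Pow V" and k: "\<forall>e\<in>E. card e = k"
    using hyp by (auto simp: uniform_hypergraph_def hypergraph_def)
  have finE: "finite E" using V E by (simp add: finite_subset)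
  define vs where "vs = enumeration V"
  define es where "es = enumeration E"
  have vs: "distinct vs" "set vs = V" using enumeration[OF V] by (simp_all add: vs_def)
  have es: "distinct es" "set es = E" using enumeration[OF finE] by (simp_all add: es_def)
  let ?S = "singular_values (incidence_matrix vs es)"
  have energy: "incidence_energy V E = sum_mset ?S"
    using False by (simp add: incidence_energy_def vs_def es_def)
  have alg: "algebraic_int s" if "s \<in># ?S" for s
    using algebraic_int_singular_values_incidence_matrix[OF es(1) that] .
  obtain c where c: "algebraic_int c" "(sum_mset ?S)\<^sup>2 = (\<Sum>s\<in>#?S. s\<^sup>2) + 2 * c"
    using square_sum_mset_algebraic_int[of ?S] alg by blast
  have "incidence_matrix vs es \<in> carrier_mat (length vs) (length es)"
    by (simp add: incidence_matrix_def)
  then have "(\<Sum>s\<in>#?S. s\<^sup>2) = (\<Sum>e\<in>set es. real (card e))"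
    using E vs es by (subst sum_squares_singular_values) (auto intro!: trace_gram_incidence_matrix)
  also have "\<dots> = real (k * card E)"
    using k by (simp add: es)
  finally show thesis
    using that[of c] c algebraic_int_sum_mset[of ?S] alg by (simp add: energy)
qed

theorem theorem9:
  fixes V :: "'a set" and E :: "'a set set" and k m :: nat
  assumes "k \<ge> 2"
    and "uniform_hypergraph k V E"
    and "card E = m"
    and "incidence_energy V E \<in> \<rat>"
  shows "\<exists>z::int. incidence_energy V E = of_int z
           \<and> (even k \<longrightarrow> even z)
           \<and> (odd k \<longrightarrow> (even z \<longleftrightarrow> even m))"
proof -
  obtain c where alg: "algebraic_int (incidence_energy V E)" "algebraic_int c"
    and sq: "(incidence_energy V E)\<^sup>2 = real (k * m) + 2 * c"
    using incidence_energy_square[OF assms(2)] assms(3) by metis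
  obtain z :: int where z: "incidence_energy V E = of_int z"
    using rational_algebraic_int_is_int[OF alg(1) assms(4)] by (auto elim: Ints_cases)
  \<comment> \<open>Solving for \<open>c\<close> transfers rationality from the energy to
    \<open>c\<close>.\<close>
  have "c = ((incidence_energy V E)\<^sup>2 - real (k * m)) / 2" using sq by simp
  also have "\<dots> \<in> \<rat>" using assms(4) by simp
  finally obtain d :: int where d: "c = of_int d"
    using rational_algebraic_int_is_int[OF alg(2)] by (auto elim: Ints_cases)
  have "real_of_int (z\<^sup>2) = real_of_int (int (k * m) + 2 * d)"
    using sq by (simp add: z d)
  then have "z\<^sup>2 = int (k * m) + 2 * d" by (simp only: of_int_eq_iff)
  then have "even (z\<^sup>2) \<longleftrightarrow> even (int (k * m))" by simp
  \<comment> \<open>A square has the parity of its base. This one equivalence contains both parity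
    claims: the right side is true for even \<open>k\<close> and reduces to \<open>even m\<close>
    for odd \<open>k\<close>.\<close>
  then have "even z \<longleftrightarrow> even k \<or> even m" by simp
  then show ?thesis using z by blast
qed

end
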